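(* Let $G_1$ and $G_2$ be finite simple undirected graphs, each with $n$ vertices and $m$ edges. Let $p,k$ be integers with $k\ge 3$, $p\ge 2n+k$ and $m\le\frac{(k-1)n}{2}+\frac{k^2}{4}$. Then $LE(G_1^*\vee\overline{K_p})=LE(G_2^*\vee\overline{K_p})$.
   Context: The Laplacian energy of a graph $H$ with $N$ vertices, $M$ edges and Laplacian eigenvalues $\nu_1,\dots,\nu_N$ (eigenvalues of $D-A$, with $A$ the adjacency matrix and $D$ the diagonal degree matrix) is $LE(H)=\sum_{i=1}^N|\nu_i-\frac{2M}{N}|$. For $G$ with vertex set $\{v_1,\dots,v_n\}$, the extended double cover $G^*$ is the bipartite graph with parts $X=\{x_1,\dots,x_n\}$, $Y=\{y_1,\dots,y_n\}$, where $x_i$ is adjacent to $y_j$ iff $i=j$ or $v_i$ is adjacent to $v_j$ in $G$. The join $H_1\vee H_2$ is the disjoint union of $H_1$ and $H_2$ together with all edges between $V(H_1)$ and $V(H_2)$. $\overline{K_p}$ is the empty (edgeless) graph on $p$ vertices. *)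

theory Defs
  imports "Graph_Theory.Graph_Theory" "Jordan_Normal_Form.Char_Poly"
begin

text \<open>
  A finite simple undirected graph is a \<^locale>\<open>pair_graph\<close>: finite vertex set, and a symmetric
  irreflexive arc relation on it. Every undirected edge is thus represented by its two
  orientations; \<open>edge_count\<close> counts it once.
\<close>

definition edge_count :: "'a pair_pre_digraph \<Rightarrow> nat" where
  "edge_count G = card ((\<lambda>(u, v). {u, v}) ` parcs G)"

definition adjacency_matrix :: "'a list \<Rightarrow> 'a pair_pre_digraph \<Rightarrow> real mat" where
  "adjacency_matrix vs G = mat (length vs) (length vs)
     (\<lambda>(i, j). if (vs ! i, vs ! j) \<in> parcs G then 1 else 0)"

definition degree_matrix :: "'a list \<Rightarrow> 'a pair_pre_digraph \<Rightarrow> real mat" where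
  "degree_matrix vs G = mat (length vs) (length vs)
     (\<lambda>(i, j). if i = j then real (out_degree (with_proj G) (vs ! i)) else 0)"

definition laplacian_matrix :: "'a list \<Rightarrow> 'a pair_pre_digraph \<Rightarrow> real mat" where
  "laplacian_matrix vs G = degree_matrix vs G - adjacency_matrix vs G"

definition vertex_list :: "'a pair_pre_digraph \<Rightarrow> 'a list" where
  "vertex_list G = (SOME vs. distinct vs \<and> set vs = pverts G)"

text \<open>
  The Laplacian eigenvalues with (algebraic) multiplicity, as the multiset of real roots of the
  characteristic polynomial. The lemmas \<open>laplacian_spectrum_enum\<close> and
  \<open>size_laplacian_spectrum\<close> below show that the choice of the vertex enumeration is immaterial
  and that no eigenvalue is lost by taking real roots only.
\<close>

definition laplacian_spectrum :: "'a pair_pre_digraph \<Rightarrow> real multiset" where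
  "laplacian_spectrum G = proots (char_poly (laplacian_matrix (vertex_list G) G))"

definition laplacian_energy :: "'a pair_pre_digraph \<Rightarrow> real" where
  "laplacian_energy G =
     (\<Sum>\<nu>\<in>#laplacian_spectrum G. \<bar>\<nu> - 2 * real (edge_count G) / real (card (pverts G))\<bar>)"

text \<open>\<open>Inl v\<close> and \<open>Inr v\<close> are the copies of \<open>v\<close> in the parts \<open>X\<close> and \<open>Y\<close>, respectively.\<close>

definition extended_double_cover :: "'a pair_pre_digraph \<Rightarrow> ('a + 'a) pair_pre_digraph" where
  "extended_double_cover G =
     \<lparr> pverts = pverts G <+> pverts G,
       parcs = {(Inl u, Inr v) | u v. u \<in> pverts G \<and> v \<in> pverts G \<and> (u = v \<or> (u, v) \<in> parcs G)}
             \<union> {(Inr v, Inl u) | u v. u \<in> pverts G \<and> v \<in> pverts G \<and> (u = v \<or> (u, v) \<in> parcs G)} \<rparr>"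

definition graph_join ::
    "'a pair_pre_digraph \<Rightarrow> 'b pair_pre_digraph \<Rightarrow> ('a + 'b) pair_pre_digraph" where
  "graph_join G H =
     \<lparr> pverts = pverts G <+> pverts H,
       parcs = {(Inl u, Inl v) | u v. (u, v) \<in> parcs G}
             \<union> {(Inr u, Inr v) | u v. (u, v) \<in> parcs H}
             \<union> {(Inl u, Inr v) | u v. u \<in> pverts G \<and> v \<in> pverts H}
             \<union> {(Inr v, Inl u) | u v. u \<in> pverts G \<and> v \<in> pverts H} \<rparr>"

definition empty_graph :: "nat \<Rightarrow> nat pair_pre_digraph" where
  "empty_graph p = \<lparr> pverts = {..<p}, parcs = {} \<rparr>"

lemma pair_graph_extended_double_cover:
  assumes "pair_graph G"
  shows "pair_graph (extended_double_cover G)"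
proof -
  interpret pair_graph G by fact
  have "parcs (extended_double_cover G)
      \<subseteq> (pverts G <+> pverts G) \<times> (pverts G <+> pverts G)"
    by (auto simp: extended_double_cover_def)
  then have "finite (parcs (extended_double_cover G))"
    by (rule finite_subset) (simp add: pair_finite_verts)
  then show ?thesis
    by unfold_locales
      (auto simp: extended_double_cover_def pair_finite_verts symmetric_def intro!: symI)
qed

lemma pair_graph_join:
  assumes "pair_graph G" and "pair_graph H"
  shows "pair_graph (graph_join G H)"
proof -
  interpret G: pair_graph G by fact
  interpret H: pair_graph H by fact
  have "parcs (graph_join G H) \<subseteq> (pverts G <+> pverts H) \<times> (pverts G <+> pverts H)"
    by (auto simp: graph_join_def G.wellformed' H.wellformed')
  then have "finite (parcs (graph_join G H))"
    by (rule finite_subset) (simp add: G.pair_finite_verts H.pair_finite_verts)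
  moreover have "sym (parcs G)" "sym (parcs H)"
    using G.pair_sym_arcs H.pair_sym_arcs by (auto simp: symmetric_def)
  ultimately show ?thesis
    by unfold_locales
      (auto simp: graph_join_def G.pair_finite_verts H.pair_finite_verts symmetric_def
        G.wellformed' H.wellformed' intro!: symI
        dest: G.pair_no_loops H.pair_no_loops symD)
qed

lemma pair_graph_empty_graph: "pair_graph (empty_graph p)"
  by unfold_locales (auto simp: empty_graph_def symmetric_def)

lemma vertex_list:
  assumes "finite (pverts G)"
  shows "distinct (vertex_list G)" and "set (vertex_list G) = pverts G"
proof -
  have "\<exists>vs. distinct vs \<and> set vs = pverts G"
    using finite_distinct_list[OF assms] by blast
  from someI_ex[OF this]
  show "distinct (vertex_list G)" and "set (vertex_list G) = pverts G"
    unfolding vertex_list_def by auto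
qed

lemma laplacian_matrix_index:
  assumes "i < length vs" and "j < length vs"
  shows "laplacian_matrix vs G $$ (i, j) =
    (if i = j then real (out_degree (with_proj G) (vs ! i)) else 0)
      - (if (vs ! i, vs ! j) \<in> parcs G then 1 else 0)"
  using assms by (simp add: laplacian_matrix_def degree_matrix_def adjacency_matrix_def)

lemma laplacian_matrix_carrier [simp]:
  "laplacian_matrix vs G \<in> carrier_mat (length vs) (length vs)"
  unfolding laplacian_matrix_def adjacency_matrix_def by (intro minus_carrier_mat mat_carrier)

lemma char_poly_laplacian_matrix_enum:
  assumes "distinct vs" and "distinct ws" and "set vs = set ws"
  shows "char_poly (laplacian_matrix vs G) = char_poly (laplacian_matrix ws G)"
proof -
  define n where "n = length vs"
  have len: "length vs = n" "length ws = n"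
    using distinct_card[OF assms(1)] distinct_card[OF assms(2)] assms(3) by (simp_all add: n_def)
  have "\<forall>i<n. \<exists>j<n. ws ! j = vs ! i"
    using assms len by (metis in_set_conv_nth)
  then obtain f where f: "\<And>i. i < n \<Longrightarrow> f i < n" "\<And>i. i < n \<Longrightarrow> ws ! f i = vs ! i"
    by metis
  have f_inj: "f i = f j \<longleftrightarrow> i = j" if "i < n" "j < n" for i j
    using f that assms(1) len by (metis nth_eq_iff_index_eq)
  define P :: "real mat" where "P = mat n n (\<lambda>(i, j). if j = f i then 1 else 0)"
  define Q :: "real mat" where "Q = mat n n (\<lambda>(i, j). if i = f j then 1 else 0)"
  define A where "A = laplacian_matrix vs G"
  define B where "B = laplacian_matrix ws G"
  have carr: "A \<in> carrier_mat n n" "B \<in> carrier_mat n n" "P \<in> carrier_mat n n" "Q \<in> carrier_mat n n"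
    using laplacian_matrix_carrier[of vs G] laplacian_matrix_carrier[of ws G] len
    by (auto simp: A_def B_def P_def Q_def)
  have AB: "A $$ (i, j) = B $$ (f i, f j)" if "i < n" "j < n" for i j
    using that f f_inj len by (simp add: A_def B_def laplacian_matrix_index)
  have PX: "(P * X) $$ (i, j) = X $$ (f i, j)"
    if "i < n" "j < n" and X: "X \<in> carrier_mat n n" for X i j
  proof -
    have "(P * X) $$ (i, j) = (\<Sum>k\<in>{0..<n}. P $$ (i, k) * X $$ (k, j))"
      using that carr by (simp add: scalar_prod_def)
    also have "\<dots> = (\<Sum>k\<in>{0..<n}. if k = f i then X $$ (k, j) else 0)"
      using that by (intro sum.cong) (auto simp: P_def)
    finally show ?thesis using that f by simp
  qed
  have "(P * Q) $$ (i, j) = 1\<^sub>m n $$ (i, j)" if "i < n" "j < n" for i j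
    unfolding PX[OF that carr(4)] using that f(1) f_inj by (simp add: Q_def)
  then have PQ: "P * Q = 1\<^sub>m n"
    using carr by (intro eq_matI) auto
  have QP: "Q * P = 1\<^sub>m n"
    using mat_mult_left_right_inverse[OF carr(3,4) PQ] .
  have "(P * B * Q) $$ (i, j) = B $$ (f i, f j)" if "i < n" "j < n" for i j
  proof -
    have "(P * B * Q) $$ (i, j) = (\<Sum>k\<in>{0..<n}. (P * B) $$ (i, k) * Q $$ (k, j))"
      using that carr by (simp add: scalar_prod_def del: assoc_mult_mat)
    also have "\<dots> = (\<Sum>k\<in>{0..<n}. if k = f j then B $$ (f i, k) else 0)"
      using that by (intro sum.cong) (auto simp: PX[OF _ _ carr(2)] Q_def)
    finally show ?thesis using that f by simp
  qed
  then have "A = P * B * Q"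
    using carr AB by (intro eq_matI) auto
  then have "similar_mat A B"
    using carr PQ QP by (intro similar_matI[of _ _ P Q n]) auto
  then show ?thesis unfolding A_def B_def by (rule char_poly_similar)
qed

lemma laplacian_spectrum_enum:
  assumes "finite (pverts G)" and "distinct vs" and "set vs = pverts G"
  shows "laplacian_spectrum G = proots (char_poly (laplacian_matrix vs G))"
  unfolding laplacian_spectrum_def
  using char_poly_laplacian_matrix_enum[OF vertex_list(1)[OF assms(1)] assms(2)]
    vertex_list(2)[OF assms(1)] assms(3)
  by simp

lemma size_proots_char_poly_symmetric:
  fixes A :: "real mat"
  assumes A: "A \<in> carrier_mat n n" and sym: "\<And>i j. i < n \<Longrightarrow> j < n \<Longrightarrow> A $$ (i, j) = A $$ (j, i)"
  shows "size (proots (char_poly A)) = n"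
proof -
  define B where "B = map_mat complex_of_real A"
  have B: "B \<in> carrier_mat n n" using A by (simp add: B_def)
  have cpB: "char_poly B = map_poly complex_of_real (char_poly A)"
    unfolding B_def by (rule of_real_hom.char_poly_hom[OF A])
  obtain as where as: "char_poly B = (\<Prod>a\<leftarrow>as. [:- a, 1:])" "length as = n"
    using char_poly_factorized[OF B] by blast
  have real: "cnj a = a" if "a \<in> set as" for a
  proof -
    have "poly (char_poly B) a = 0"
      using that unfolding as(1) by (simp add: poly_prod_list prod_list_zero_iff)
    then have "eigenvalue B a" using eigenvalue_root_char_poly[OF B] by simp
    then obtain v where v: "v \<in> carrier_vec n" "v \<noteq> 0\<^sub>v n" "B *\<^sub>v v = a \<cdot>\<^sub>v v"
      using B unfolding eigenvalue_def eigenvector_def by auto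
    have ev: "(\<Sum>j<n. complex_of_real (A $$ (i, j)) * v $ j) = a * v $ i" if "i < n" for i
    proof -
      have "(B *\<^sub>v v) $ i = (\<Sum>j<n. complex_of_real (A $$ (i, j)) * v $ j)"
        using that A v(1) by (simp add: B_def scalar_prod_def atLeast0LessThan)
      then show ?thesis using v that by simp
    qed
    define s where "s = (\<Sum>i<n. cnj (v $ i) * v $ i)"
    have "a * s = (\<Sum>i<n. cnj (v $ i) * (\<Sum>j<n. complex_of_real (A $$ (i, j)) * v $ j))"
      unfolding s_def sum_distrib_left[of a] by (intro sum.cong refl) (simp add: ev)
    also have "\<dots> = (\<Sum>i<n. \<Sum>j<n. cnj (v $ i) * (complex_of_real (A $$ (i, j)) * v $ j))"
      by (simp add: sum_distrib_left)
    also have "\<dots> = (\<Sum>j<n. \<Sum>i<n. cnj (v $ i) * (complex_of_real (A $$ (i, j)) * v $ j))"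
      by (rule sum.swap)
    also have "\<dots> = (\<Sum>j<n. \<Sum>i<n. v $ j * (complex_of_real (A $$ (j, i)) * cnj (v $ i)))"
      by (intro sum.cong refl) (use sym in \<open>auto simp: mult_ac\<close>)
    also have "\<dots> = (\<Sum>j<n. v $ j * cnj (\<Sum>i<n. complex_of_real (A $$ (j, i)) * v $ i))"
      by (simp add: sum_distrib_left)
    also have "\<dots> = cnj a * s"
      unfolding s_def sum_distrib_left[of "cnj a"]
      by (intro sum.cong refl) (use ev in \<open>simp del: cnj_sum\<close>)
    finally have "a * s = cnj a * s" .
    moreover have "s \<noteq> 0"
    proof
      assume "s = 0"
      moreover have "s = complex_of_real (\<Sum>i<n. (cmod (v $ i))\<^sup>2)"
        by (simp add: s_def complex_norm_square mult.commute del: of_real_power)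
      ultimately have "(\<Sum>i<n. (cmod (v $ i))\<^sup>2) = 0"
        by (metis of_real_eq_0_iff)
      then have "\<forall>i<n. v $ i = 0" by (simp add: sum_nonneg_eq_0_iff)
      then have "v = 0\<^sub>v n" using v(1) by (intro eq_vecI) auto
      with v(2) show False ..
    qed
    ultimately show ?thesis by simp
  qed
  define bs where "bs = map Re as"
  have as_bs: "as = map complex_of_real bs"
    unfolding bs_def map_map by (rule map_idI[symmetric]) (use real in \<open>simp add: complex_eq_iff\<close>)
  interpret h: map_poly_inj_idom_hom complex_of_real ..
  have "map_poly complex_of_real (char_poly A) = map_poly complex_of_real (\<Prod>b\<leftarrow>bs. [:- b, 1:])"
    unfolding cpB[symmetric] as(1) as_bs
    by (induction bs) (simp_all add: h.hom_mult map_poly_pCons del: mult_pCons_left)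
  then have "char_poly A = (\<Prod>b\<leftarrow>bs. [:- b, 1:])"
    by (rule h.injectivity)
  moreover have "proots (\<Prod>b\<leftarrow>bs. [:- b, 1:]) = mset bs"
  proof (induction bs)
    case (Cons b bs)
    have "(\<Prod>b\<leftarrow>bs. [:- b, 1:]) \<noteq> 0" by (auto simp: prod_list_zero_iff)
    then have "proots ([:- b, 1:] * (\<Prod>b\<leftarrow>bs. [:- b, 1:])) = proots [:- b, 1:] + mset bs"
      unfolding Cons.IH[symmetric] by (intro proots_mult) simp_all
    then show ?case by (simp del: mult_pCons_left)
  qed simp
  ultimately show ?thesis using as(2) by (simp add: bs_def)
qed

lemma size_laplacian_spectrum:
  assumes "pair_graph G"
  shows "size (laplacian_spectrum G) = card (pverts G)"
proof -
  interpret pair_graph G by fact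
  have "(u, v) \<in> parcs G \<longleftrightarrow> (v, u) \<in> parcs G" for u v
    using pair_sym_arcs by (auto simp: symmetric_def dest: symD)
  then have "size (laplacian_spectrum G) = length (vertex_list G)"
    unfolding laplacian_spectrum_def
    by (intro size_proots_char_poly_symmetric) (auto simp: laplacian_matrix_index)
  then show ?thesis
    using vertex_list[OF pair_finite_verts] by (metis distinct_card)
qed

end

theory Submission
  imports Defs "Jordan_Normal_Form.Schur_Decomposition"
begin

text \<open>
  The energy of the join is a sum of distances from its average degree \<open>a\<close>, which depends only on
  numbers of vertices and edges. If \<open>a\<close> lies below all eigenvalues that depend on the structure of
  the double cover, these enter the energy only through their sum, which is again a matter of
  counting. This works for the join of any two graphs \<open>H\<close> and \<open>K\<close>.

  Let \<open>H\<close> have \<open>N\<close> vertices and \<open>K\<close> have \<open>p\<close>. The Laplacian matrix of the join \<open>H \<or> K\<close> has diagonal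
  blocks \<open>B = L(H) + p I\<close> and \<open>D = L(K) + N I\<close>, and every entry of its off-diagonal blocks is \<open>-1\<close>.
  Every row of \<open>B\<close> sums to \<open>p\<close>, so the all-ones vector is an eigenvector of \<open>B\<close>, and one block
  column operation clears an off-diagonal block of \<open>x I - L(H \<or> K)\<close>:
  the characteristic polynomial of \<open>L(H \<or> K)\<close> is that of \<open>B\<close> times a function of \<open>x\<close> that depends on \<open>H\<close>
  through \<open>N\<close> alone (\<open>poly_char_poly_four_block_const_row_sum\<close>). Hence for two graphs on \<open>N\<close> vertices
  the multiset of eigenvalues of \<open>H\<^sub>1 \<or> K\<close> together with that of \<open>B\<^sub>2\<close> equals the one of \<open>H\<^sub>2 \<or> K\<close>
  together with that of \<open>B\<^sub>1\<close>. In this cross-multiplied form the common factor never has to be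
  computed (\<open>char_poly_four_block_exchange\<close>).

  It remains to see that the eigenvalues \<open>\<nu>\<close> of \<open>B\<^sub>1\<close> and of \<open>B\<^sub>2\<close> give the same sum of \<open>\<bar>\<nu> - a\<bar>\<close>. They
  are all at least \<open>p\<close> (\<open>eigenvalue_ge_row_sum\<close>). If \<open>a \<le> p\<close>, the absolute values disappear and the
  sum becomes a trace, which depends only on the numbers of vertices and of edges
  (\<open>sum_abs_shifted_laplacian_proots\<close>). This gives \<open>laplacian_energy_join_eq\<close>.

  The double cover has \<open>2 n\<close> vertices and \<open>n + 2 m\<close> edges. For its join with an edgeless graph, the
  condition \<open>a \<le> p\<close> reads \<open>4 m + 2 n \<le> p (p - 2 n)\<close>. The bound on \<open>m\<close> says exactly that
  \<open>4 m + 2 n \<le> (2 n + k) k\<close>, and \<open>p \<ge> 2 n + k\<close> gives the rest.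
\<close>

section \<open>Roots of the characteristic polynomial and the trace\<close>

lemma split_poly_eq_prod_list_proots:
  fixes p :: "'a :: idom poly"
  assumes "size (proots p) = degree p" and "lead_coeff p = 1"
  shows "\<exists>xs. mset xs = proots p \<and> p = (\<Prod>x\<leftarrow>xs. [:- x, 1:])"
  using assms
proof (induction "degree p" arbitrary: p)
  case 0
  then have "p = 1" by (metis degree_0_id one_poly_eq_simps(1) pCons_one)
  then show ?case by (intro exI[of _ "[]"]) simp
next
  case (Suc d)
  then obtain x where x: "x \<in># proots p" by (metis multiset_nonemptyE size_empty Zero_not_Suc)
  have p0: "p \<noteq> 0" using Suc by auto
  then have "poly p x = 0" using x by simp
  then obtain q where q: "p = [:- x, 1:] * q" by (metis poly_eq_0_iff_dvd dvdE)
  have q0: "q \<noteq> 0" using q p0 by auto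
  have pr: "proots p = add_mset x (proots q)"
    unfolding q by (subst proots_mult) (use q0 in \<open>auto simp del: mult_pCons_left\<close>)
  have deg: "degree p = Suc (degree q)"
    unfolding q by (subst degree_mult_eq) (use q0 in \<open>auto simp del: mult_pCons_left\<close>)
  have "lead_coeff q = 1"
    using Suc.prems(2) unfolding q lead_coeff_mult by simp
  moreover have "d = degree q" "size (proots q) = degree q"
    using deg pr Suc by auto
  ultimately obtain xs where xs: "mset xs = proots q" "q = (\<Prod>x\<leftarrow>xs. [:- x, 1:])"
    using Suc.hyps(1) by blast
  have "p = (\<Prod>x\<leftarrow>x # xs. [:- x, 1:])"
    using q xs(2) by (simp del: mult_pCons_left)
  moreover have "mset (x # xs) = proots p"
    by (simp add: pr xs(1))
  ultimately show ?case by blast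
qed

lemma trace_similar_mat_wit:
  fixes A B :: "'a :: comm_ring_1 mat"
  assumes A: "A \<in> carrier_mat n n" and wit: "similar_mat_wit A B P Q"
  shows "(\<Sum>i<n. A $$ (i, i)) = (\<Sum>i<n. B $$ (i, i))"
proof -
  note w = similar_mat_witD2[OF A wit]
  have tr_comm: "(\<Sum>i<n. (X * Y) $$ (i, i)) = (\<Sum>i<n. (Y * X) $$ (i, i))"
    if "X \<in> carrier_mat n n" "Y \<in> carrier_mat n n" for X Y :: "'a mat"
  proof -
    have "(\<Sum>i<n. (X * Y) $$ (i, i)) = (\<Sum>i<n. \<Sum>k<n. X $$ (i, k) * Y $$ (k, i))"
      using that by (intro sum.cong) (auto simp: scalar_prod_def atLeast0LessThan)
    also have "\<dots> = (\<Sum>k<n. \<Sum>i<n. Y $$ (k, i) * X $$ (i, k))"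
      by (subst sum.swap) (simp add: mult.commute)
    also have "\<dots> = (\<Sum>k<n. (Y * X) $$ (k, k))"
      using that by (intro sum.cong) (auto simp: scalar_prod_def atLeast0LessThan)
    finally show ?thesis .
  qed
  have "A = P * (B * Q)"
    using w(3) assoc_mult_mat[OF w(6,5,7)] by simp
  then have "(\<Sum>i<n. A $$ (i, i)) = (\<Sum>i<n. (P * (B * Q)) $$ (i, i))"
    by simp
  also have "\<dots> = (\<Sum>i<n. (B * Q * P) $$ (i, i))"
    using w by (intro tr_comm) auto
  also have "B * Q * P = B"
    using assoc_mult_mat[OF w(5,7,6)] w(2,5) by simp
  finally show ?thesis .
qed

text \<open>
  If all eigenvalues lie in the ground field, Schur's theorem makes \<open>A\<close> similar to a triangular
  matrix that carries them on its diagonal, and similarity preserves the trace.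
\<close>

lemma sum_mset_proots_char_poly:
  fixes A :: "real mat"
  assumes A: "A \<in> carrier_mat n n" and size: "size (proots (char_poly A)) = n"
  shows "\<Sum>\<^sub># (proots (char_poly A)) = (\<Sum>i<n. A $$ (i, i))"
proof -
  obtain es where es: "mset es = proots (char_poly A)" "char_poly A = (\<Prod>e\<leftarrow>es. [:- e, 1:])"
    using split_poly_eq_prod_list_proots[of "char_poly A"] degree_monic_char_poly[OF A] size by auto
  obtain B P Q where "schur_decomposition A es = (B, P, Q)"
    by (cases "schur_decomposition A es")
  from schur_decomposition[OF A es(2) this]
  have B: "similar_mat_wit A B P Q" "diag_mat B = es" by auto
  then have "B \<in> carrier_mat n n" using similar_mat_witD2[OF A] by blast
  have "\<Sum>\<^sub># (proots (char_poly A)) = sum_list (diag_mat B)"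
    unfolding es(1)[symmetric] B(2) by (rule sum_mset_sum_list)
  also have "\<dots> = (\<Sum>i<n. B $$ (i, i))"
    using \<open>B \<in> carrier_mat n n\<close>
    by (simp add: diag_mat_def interv_sum_list_conv_sum_set_nat atLeast0LessThan)
  also have "\<dots> = (\<Sum>i<n. A $$ (i, i))"
    using trace_similar_mat_wit[OF A B(1)] by simp
  finally show ?thesis .
qed

section \<open>A lower bound for eigenvalues from row sums\<close>

text \<open>
  This is the maximum principle: at a coordinate \<open>i\<close> where an eigenvector \<open>v\<close> has largest modulus,
  \<open>v\<^sub>j v\<^sub>i \<le> v\<^sub>i\<^sup>2\<close> for all \<open>j\<close>, so replacing each \<open>v\<^sub>j\<close> by \<open>v\<^sub>i\<close> in the \<open>i\<close>-th row of \<open>A v = \<mu> v\<close> can only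
  decrease \<open>\<mu> v\<^sub>i\<^sup>2\<close>, and turns it into \<open>c v\<^sub>i\<^sup>2\<close>. Multiplying by \<open>v\<^sub>i\<close> avoids a case distinction on its
  sign. For \<open>c = 0\<close> it is the nonnegativity of Laplacian eigenvalues.
\<close>

lemma eigenvalue_ge_row_sum:
  fixes A :: "real mat"
  assumes A: "A \<in> carrier_mat n n"
    and offdiag: "\<And>i j. i < n \<Longrightarrow> j < n \<Longrightarrow> i \<noteq> j \<Longrightarrow> A $$ (i, j) \<le> 0"
    and rows: "\<And>i. i < n \<Longrightarrow> (\<Sum>j<n. A $$ (i, j)) = c"
    and ev: "eigenvalue A \<mu>"
  shows "c \<le> \<mu>"
proof -
  obtain v where v: "v \<in> carrier_vec n" "v \<noteq> 0\<^sub>v n" "A *\<^sub>v v = \<mu> \<cdot>\<^sub>v v"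
    using ev A unfolding eigenvalue_def eigenvector_def by auto
  then obtain l where l: "l < n" "v $ l \<noteq> 0"
    by (metis carrier_vecD eq_vecI index_zero_vec(1) index_zero_vec(2))
  have "Max ((\<lambda>j. \<bar>v $ j\<bar>) ` {..<n}) \<in> (\<lambda>j. \<bar>v $ j\<bar>) ` {..<n}"
    using l(1) by (intro Max_in) auto
  then obtain i where i: "i < n" and i_eq: "Max ((\<lambda>j. \<bar>v $ j\<bar>) ` {..<n}) = \<bar>v $ i\<bar>"
    by auto
  have i_max: "\<bar>v $ j\<bar> \<le> \<bar>v $ i\<bar>" if "j < n" for j
    unfolding i_eq[symmetric] using that by (intro Max_ge) auto
  have "0 < \<bar>v $ i\<bar>" using i_max[OF l(1)] l(2) by linarith
  have "(A *\<^sub>v v) $ i = (\<Sum>j<n. A $$ (i, j) * v $ j)"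
    using A v(1) i by (simp add: scalar_prod_def atLeast0LessThan)
  then have "\<mu> * v $ i = (\<Sum>j<n. A $$ (i, j) * v $ j)"
    using v i by simp
  then have "\<mu> * v $ i * v $ i = (\<Sum>j<n. A $$ (i, j) * (v $ j * v $ i))"
    by (simp add: sum_distrib_right mult.assoc)
  also have "\<dots> \<ge> (\<Sum>j<n. A $$ (i, j) * (v $ i * v $ i))"
  proof (rule sum_mono)
    fix j assume "j \<in> {..<n}"
    then have j: "j < n" by simp
    have "v $ j * v $ i \<le> \<bar>v $ j\<bar> * \<bar>v $ i\<bar>" by (metis abs_ge_self abs_mult)
    also have "\<dots> \<le> \<bar>v $ i\<bar> * \<bar>v $ i\<bar>" using i_max[OF j] by (intro mult_right_mono) auto
    finally have "v $ j * v $ i \<le> v $ i * v $ i" by simp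
    then show "A $$ (i, j) * (v $ i * v $ i) \<le> A $$ (i, j) * (v $ j * v $ i)"
      using offdiag[OF i j] by (cases "i = j") (auto intro: mult_left_mono_neg)
  qed
  also have "(\<Sum>j<n. A $$ (i, j) * (v $ i * v $ i)) = c * v $ i * v $ i"
    using rows[OF i] by (simp add: sum_distrib_right[symmetric] mult.assoc)
  finally have "c * (v $ i * v $ i) \<le> \<mu> * (v $ i * v $ i)"
    by (simp add: mult.assoc)
  moreover have "0 < v $ i * v $ i"
    using \<open>0 < \<bar>v $ i\<bar>\<close> by (metis abs_mult_self_eq mult_pos_pos)
  ultimately show ?thesis by (rule mult_right_le_imp_le)
qed

section \<open>Block matrices with constant off-diagonal blocks\<close>

definition const_mat :: "nat \<Rightarrow> nat \<Rightarrow> 'a \<Rightarrow> 'a mat" where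
  "const_mat r s c = mat r s (\<lambda>_. c)"

lemma const_mat_carrier [simp]: "const_mat r s c \<in> carrier_mat r s"
  by (simp add: const_mat_def)

lemma index_const_mat [simp]: "i < r \<Longrightarrow> j < s \<Longrightarrow> const_mat r s c $$ (i, j) = c"
  by (simp add: const_mat_def)

lemma dim_const_mat [simp]: "dim_row (const_mat r s c) = r" "dim_col (const_mat r s c) = s"
  by (simp_all add: const_mat_def)

text \<open>
  Constant row sums \<open>y\<close> mean that \<open>A\<close> sends a constant matrix to \<open>y\<close> times itself. Adding \<open>-1/y\<close> times
  the sum of the first \<open>n\<close> columns to each later column therefore clears the upper right block,
  and changes the lower right block by the constant \<open>-n/y\<close>. This is the Schur complement of \<open>A\<close>, but
  \<open>A\<close> itself may be singular.
\<close>

lemma det_four_block_const_row_sum: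
  fixes A D :: "'a :: field mat"
  assumes A: "A \<in> carrier_mat n n" and D: "D \<in> carrier_mat p p"
    and rows: "\<And>i. i < n \<Longrightarrow> (\<Sum>j<n. A $$ (i, j)) = y" and "y \<noteq> 0"
  shows "det (four_block_mat A (const_mat n p 1) (const_mat p n 1) D)
       = det A * det (D - const_mat p p (of_nat n / y))"
proof -
  let ?M = "four_block_mat A (const_mat n p 1) (const_mat p n 1) D"
  \<comment> \<open>multiplication by \<open>?E\<close> on the right performs the column operation\<close>
  let ?E = "four_block_mat (1\<^sub>m n) (const_mat n p (- 1 / y)) (0\<^sub>m p n) (1\<^sub>m p)"
  have upper: "A * const_mat n p (- 1 / y) + const_mat n p 1 * 1\<^sub>m p = 0\<^sub>m n p"
  proof (rule eq_matI)
    fix i j assume "i < dim_row (0\<^sub>m n p :: 'a mat)" "j < dim_col (0\<^sub>m n p :: 'a mat)"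
    then have ij: "i < n" "j < p" by simp_all
    have "(A * const_mat n p (- 1 / y)) $$ (i, j) = (\<Sum>k<n. A $$ (i, k) * (- 1 / y))"
      using A ij by (simp add: scalar_prod_def atLeast0LessThan)
    also have "\<dots> = - 1"
      using rows[OF ij(1)] \<open>y \<noteq> 0\<close> by (simp only: sum_distrib_right[symmetric]) simp
    finally show "(A * const_mat n p (- 1 / y) + const_mat n p 1 * 1\<^sub>m p) $$ (i, j)
      = 0\<^sub>m n p $$ (i, j)"
      using ij A by (simp add: right_mult_one_mat[of _ n p])
  qed (use A in auto)
  have lower: "const_mat p n 1 * const_mat n p (- 1 / y) + D * 1\<^sub>m p
      = D - const_mat p p (of_nat n / y)"
    using D by (intro eq_matI) (auto simp: scalar_prod_def right_mult_one_mat[of _ p p])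
  have "?M * ?E = four_block_mat A (0\<^sub>m n p) (const_mat p n 1) (D - const_mat p p (of_nat n / y))"
    using A D upper lower
    by (subst mult_four_block_mat[where ?nr1.0 = n and ?n1.0 = n and ?n2.0 = p and ?nr2.0 = p
          and ?nc1.0 = n and ?nc2.0 = p])
      (auto intro!: cong_four_block_mat simp: right_mult_one_mat[of _ p n])
  then have "det (?M * ?E) = det A * det (D - const_mat p p (of_nat n / y))"
    using A D
    by (simp add: det_four_block_mat_upper_right_zero[of _ n _ p] minus_carrier_mat[of _ p p])
  moreover have "det (?M * ?E) = det ?M * det ?E"
    using A D by (intro det_mult[of _ "n + p"]) auto
  moreover have "det ?E = 1"
    by (subst det_four_block_mat_lower_left_zero[of _ n _ p]) auto
  ultimately show ?thesis by simp
qed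

lemma poly_char_poly_eq_det:
  fixes A :: "'a :: field mat"
  assumes "A \<in> carrier_mat n n"
  shows "poly (char_poly A) x = det (x \<cdot>\<^sub>m 1\<^sub>m n - A)"
proof -
  have "- char_matrix A x = x \<cdot>\<^sub>m 1\<^sub>m n - A"
    using assms by (intro eq_matI) (auto simp: char_matrix_def)
  then show ?thesis using char_poly_matrix[OF assms] by simp
qed

lemma poly_char_poly_four_block_const_row_sum:
  fixes A D :: "'a :: field mat"
  assumes A: "A \<in> carrier_mat n n" and D: "D \<in> carrier_mat p p"
    and rows: "\<And>i. i < n \<Longrightarrow> (\<Sum>j<n. A $$ (i, j)) = c" and "x \<noteq> c"
  shows "poly (char_poly (four_block_mat A (const_mat n p (- 1)) (const_mat p n (- 1)) D)) x
       = poly (char_poly A) x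
           * det (x \<cdot>\<^sub>m 1\<^sub>m p - D - const_mat p p (of_nat n / (x - c)))"
proof -
  have "x \<cdot>\<^sub>m 1\<^sub>m (n + p) - four_block_mat A (const_mat n p (- 1)) (const_mat p n (- 1)) D
      = four_block_mat (x \<cdot>\<^sub>m 1\<^sub>m n - A) (const_mat n p 1) (const_mat p n 1) (x \<cdot>\<^sub>m 1\<^sub>m p - D)"
    using A D by (intro eq_matI) (auto split: if_splits)
  moreover have "(\<Sum>j<n. (x \<cdot>\<^sub>m 1\<^sub>m n - A) $$ (i, j)) = x - c" if "i < n" for i
  proof -
    have "(\<Sum>j<n. (x \<cdot>\<^sub>m 1\<^sub>m n - A) $$ (i, j)) = (\<Sum>j<n. (if i = j then x else 0) - A $$ (i, j))"
      using A that by (intro sum.cong) auto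
    then show ?thesis using that rows by (simp add: sum_subtractf)
  qed
  moreover have "x \<cdot>\<^sub>m 1\<^sub>m n - A \<in> carrier_mat n n" "x \<cdot>\<^sub>m 1\<^sub>m p - D \<in> carrier_mat p p"
    using A D by auto
  moreover have "four_block_mat A (const_mat n p (- 1)) (const_mat p n (- 1)) D
      \<in> carrier_mat (n + p) (n + p)"
    using A D by simp
  ultimately show ?thesis
    using det_four_block_const_row_sum[of "x \<cdot>\<^sub>m 1\<^sub>m n - A" n "x \<cdot>\<^sub>m 1\<^sub>m p - D" p "x - c"]
      poly_char_poly_eq_det[of "four_block_mat A (const_mat n p (- 1)) (const_mat p n (- 1)) D" "n + p" x]
      poly_char_poly_eq_det[OF A, of x] \<open>x \<noteq> c\<close>
    by (metis right_minus_eq)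
qed

text \<open>
  The factor by which the two characteristic polynomials of the block matrices differ from those of
  \<open>A\<^sub>1\<close> and \<open>A\<^sub>2\<close> is the same at every \<open>x \<noteq> c\<close>, and infinitely many points determine a polynomial.
\<close>

lemma char_poly_four_block_exchange:
  fixes A\<^sub>1 A\<^sub>2 D :: "real mat"
  assumes A: "A\<^sub>1 \<in> carrier_mat n n" "A\<^sub>2 \<in> carrier_mat n n" and D: "D \<in> carrier_mat p p"
    and rows: "\<And>i. i < n \<Longrightarrow> (\<Sum>j<n. A\<^sub>1 $$ (i, j)) = c" "\<And>i. i < n \<Longrightarrow> (\<Sum>j<n. A\<^sub>2 $$ (i, j)) = c"
  shows "char_poly (four_block_mat A\<^sub>1 (const_mat n p (- 1)) (const_mat p n (- 1)) D) * char_poly A\<^sub>2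
       = char_poly (four_block_mat A\<^sub>2 (const_mat n p (- 1)) (const_mat p n (- 1)) D) * char_poly A\<^sub>1"
    (is "?l = ?r")
proof (rule ccontr)
  assume "?l \<noteq> ?r"
  then have "finite {x. poly (?l - ?r) x = 0}" by (intro poly_roots_finite) simp
  moreover have "UNIV - {c} \<subseteq> {x. poly (?l - ?r) x = 0}"
    using A D rows by (auto simp: poly_char_poly_four_block_const_row_sum)
  moreover have "infinite (UNIV - {c} :: real set)"
    by (simp add: infinite_UNIV_char_0)
  ultimately show False using finite_subset by blast
qed

section \<open>Degrees, row sums and trace of the Laplacian matrix\<close>

lemma out_degree_eq_card: "out_degree (with_proj G) u = card {w. (u, w) \<in> parcs G}"
proof -
  have "out_arcs (with_proj G) u = Pair u ` {w. (u, w) \<in> parcs G}"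
    by (auto simp: out_arcs_def)
  then show ?thesis
    by (simp add: out_degree_def card_image inj_on_def)
qed

text \<open>
  The handshake lemma: the degrees count arcs, and the map that forgets the orientation of arcs is
  exactly two-to-one because the graph is symmetric and has no loops.
\<close>

lemma sum_out_degree:
  assumes "pair_graph G"
  shows "(\<Sum>v\<in>pverts G. out_degree (with_proj G) v) = 2 * edge_count G"
proof -
  interpret pair_graph G by fact
  let ?end = "\<lambda>(u, v). {u, v}"
  have sym: "(v, u) \<in> parcs G" if "(u, v) \<in> parcs G" for u v
    using that pair_sym_arcs by (auto simp: symmetric_def dest: symD)
  have fin: "finite {w. (v, w) \<in> parcs G}" for v
    by (rule finite_subset[OF _ pair_finite_verts]) (auto simp: wellformed')
  have "(\<Sum>v\<in>pverts G. out_degree (with_proj G) v) = card (SIGMA v:pverts G. {w. (v, w) \<in> parcs G})"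
    using fin pair_finite_verts by (simp add: out_degree_eq_card)
  also have "(SIGMA v:pverts G. {w. (v, w) \<in> parcs G}) = parcs G"
    by (auto simp: wellformed')
  also have "card (parcs G) = (\<Sum>e\<in>?end ` parcs G. card {a \<in> parcs G. ?end a = e})"
    unfolding card_eq_sum by (rule sum.image_gen[OF pair_finite_arcs])
  also have "\<dots> = (\<Sum>e\<in>?end ` parcs G. 2)"
  proof (rule sum.cong[OF refl])
    fix e assume "e \<in> ?end ` parcs G"
    then obtain u v where uv: "(u, v) \<in> parcs G" "e = {u, v}" by auto
    then have "{a \<in> parcs G. ?end a = e} = {(u, v), (v, u)}"
      using sym by (auto simp: doubleton_eq_iff)
    moreover have "u \<noteq> v" using pair_no_loops[OF uv(1)] by simp
    ultimately show "card {a \<in> parcs G. ?end a = e} = 2" by simp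
  qed
  finally show ?thesis by (simp add: edge_count_def)
qed

lemma sum_nth_eq_sum_set:
  assumes "distinct xs"
  shows "(\<Sum>i<length xs. f (xs ! i)) = sum f (set xs)"
  by (rule sum.reindex_bij_betw) (use assms in \<open>simp add: bij_betw_nth lessThan_def\<close>)

lemma laplacian_matrix_row_sum:
  assumes "pair_graph G" and "distinct vs" and "set vs = pverts G" and "i < length vs"
  shows "(\<Sum>j<length vs. laplacian_matrix vs G $$ (i, j)) = 0"
proof -
  interpret pair_graph G by fact
  let ?u = "vs ! i"
  have "(\<Sum>j<length vs. if (?u, vs ! j) \<in> parcs G then 1 else 0 :: real)
      = (\<Sum>w\<in>pverts G. if (?u, w) \<in> parcs G then 1 else 0)"
    using assms(2,3) by (subst sum_nth_eq_sum_set) simp_all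
  also have "\<dots> = real (card {w \<in> pverts G. (?u, w) \<in> parcs G})"
    using pair_finite_verts by (simp add: sum.If_cases Int_def)
  also have "{w \<in> pverts G. (?u, w) \<in> parcs G} = {w. (?u, w) \<in> parcs G}"
    by (auto simp: wellformed')
  finally show ?thesis
    using assms(4) by (simp add: laplacian_matrix_index sum_subtractf out_degree_eq_card)
qed

lemma trace_laplacian_matrix:
  assumes "pair_graph G" and "distinct vs" and "set vs = pverts G"
  shows "(\<Sum>i<length vs. laplacian_matrix vs G $$ (i, i)) = 2 * real (edge_count G)"
proof -
  interpret pair_graph G by fact
  have "(v, v) \<notin> parcs G" for v using pair_no_loops by fastforce
  then have "(\<Sum>i<length vs. laplacian_matrix vs G $$ (i, i))
      = (\<Sum>i<length vs. real (out_degree (with_proj G) (vs ! i)))"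
    by (simp add: laplacian_matrix_index)
  also have "\<dots> = (\<Sum>v\<in>pverts G. real (out_degree (with_proj G) v))"
    using assms(2,3) by (subst sum_nth_eq_sum_set) simp_all
  also have "\<dots> = 2 * real (edge_count G)"
    using sum_out_degree[OF assms(1)] by (simp flip: of_nat_sum)
  finally show ?thesis .
qed

section \<open>The Laplacian matrix shifted by a scalar\<close>

text \<open>
  In a join, a vertex of one side gains all \<open>c\<close> vertices of the other side as neighbours. This is
  the resulting diagonal block of the Laplacian matrix.
\<close>

definition shifted_laplacian :: "real \<Rightarrow> 'a list \<Rightarrow> 'a pair_pre_digraph \<Rightarrow> real mat" where
  "shifted_laplacian c vs G = laplacian_matrix vs G + c \<cdot>\<^sub>m 1\<^sub>m (length vs)"

lemma shifted_laplacian_carrier [simp]: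
  "shifted_laplacian c vs G \<in> carrier_mat (length vs) (length vs)"
  by (simp add: shifted_laplacian_def)

lemma dim_shifted_laplacian [simp]:
  "dim_row (shifted_laplacian c vs G) = length vs"
  "dim_col (shifted_laplacian c vs G) = length vs"
  using shifted_laplacian_carrier by (blast dest: carrier_matD)+

lemma shifted_laplacian_index:
  assumes "i < length vs" and "j < length vs"
  shows "shifted_laplacian c vs G $$ (i, j)
    = laplacian_matrix vs G $$ (i, j) + (if i = j then c else 0)"
  using assms by (simp add: shifted_laplacian_def)

lemma shifted_laplacian_row_sum:
  assumes "pair_graph G" and "distinct vs" and "set vs = pverts G" and "i < length vs"
  shows "(\<Sum>j<length vs. shifted_laplacian c vs G $$ (i, j)) = c"
proof -
  have "(\<Sum>j<length vs. shifted_laplacian c vs G $$ (i, j))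
      = (\<Sum>j<length vs. laplacian_matrix vs G $$ (i, j) + (if i = j then c else 0))"
    using assms(4) by (intro sum.cong) (auto simp: shifted_laplacian_index)
  then show ?thesis
    using assms by (simp add: sum.distrib laplacian_matrix_row_sum)
qed

text \<open>
  For \<open>a\<close> below the spectrum, the sum of the distances to \<open>a\<close> is linear in the eigenvalues and hence equal to
  the trace minus \<open>a\<close> times the number of vertices; no other information on the graph survives.
\<close>

lemma sum_abs_shifted_laplacian_proots:
  assumes "pair_graph G" and "distinct vs" and "set vs = pverts G" and "a \<le> c"
  shows "(\<Sum>\<nu>\<in>#proots (char_poly (shifted_laplacian c vs G)). \<bar>\<nu> - a\<bar>)
       = 2 * real (edge_count G) + real (card (pverts G)) * (c - a)"
proof -
  interpret pair_graph G by fact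
  let ?A = "shifted_laplacian c vs G" and ?n = "length vs"
  let ?R = "proots (char_poly ?A)"
  have n: "card (pverts G) = ?n" using assms(2,3) by (metis distinct_card)
  have sym: "(u, v) \<in> parcs G \<longleftrightarrow> (v, u) \<in> parcs G" for u v
    using pair_sym_arcs by (auto simp: symmetric_def dest: symD)
  have size: "size ?R = ?n"
    by (rule size_proots_char_poly_symmetric)
      (use sym in \<open>auto simp: shifted_laplacian_index laplacian_matrix_index\<close>)
  have "a \<le> \<nu>" if "\<nu> \<in># ?R" for \<nu>
  proof -
    have "char_poly ?A \<noteq> 0" using degree_monic_char_poly[of ?A ?n] by auto
    then have "poly (char_poly ?A) \<nu> = 0" using that by simp
    then have "eigenvalue ?A \<nu>" using eigenvalue_root_char_poly[of ?A ?n] by simp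
    moreover have "?A $$ (i, j) \<le> 0" if "i < ?n" "j < ?n" "i \<noteq> j" for i j
      using that by (simp add: shifted_laplacian_index laplacian_matrix_index)
    ultimately have "c \<le> \<nu>"
      using eigenvalue_ge_row_sum[OF shifted_laplacian_carrier] shifted_laplacian_row_sum[OF assms(1-3)]
      by blast
    then show ?thesis using \<open>a \<le> c\<close> by simp
  qed
  then have "(\<Sum>\<nu>\<in>#?R. \<bar>\<nu> - a\<bar>) = (\<Sum>\<nu>\<in>#?R. \<nu> - a)"
    by (intro arg_cong[of _ _ sum_mset] image_mset_cong) simp
  also have "\<dots> = \<Sum>\<^sub># ?R - real ?n * a"
  proof -
    have "(\<Sum>\<nu>\<in>#M. \<nu> - a) = \<Sum>\<^sub># M - real (size M) * a" for M
      by (induction M) (simp_all add: algebra_simps)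
    then show ?thesis by (simp add: size)
  qed
  also have "\<Sum>\<^sub># ?R = (\<Sum>i<?n. ?A $$ (i, i))"
    using size by (intro sum_mset_proots_char_poly) auto
  also have "\<dots> = 2 * real (edge_count G) + real ?n * c"
    using trace_laplacian_matrix[OF assms(1-3)]
    by (simp add: shifted_laplacian_index sum.distrib)
  finally show ?thesis by (simp add: n algebra_simps)
qed

section \<open>Joins and extended double covers\<close>

lemma out_degree_graph_join:
  assumes "pair_graph G" and "pair_graph H"
  shows "u \<in> pverts G \<Longrightarrow> out_degree (with_proj (graph_join G H)) (Inl u)
           = out_degree (with_proj G) u + card (pverts H)"
    and "v \<in> pverts H \<Longrightarrow> out_degree (with_proj (graph_join G H)) (Inr v)
           = out_degree (with_proj H) v + card (pverts G)"
proof -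
  interpret G: pair_graph G by fact
  interpret H: pair_graph H by fact
  have fin: "finite {w. (u, w) \<in> parcs G}" "finite {w. (v, w) \<in> parcs H}" for u v
    by (rule finite_subset[OF _ G.pair_finite_verts], force simp: G.wellformed')
      (rule finite_subset[OF _ H.pair_finite_verts], force simp: H.wellformed')
  show "out_degree (with_proj (graph_join G H)) (Inl u)
           = out_degree (with_proj G) u + card (pverts H)" if "u \<in> pverts G"
  proof -
    have "{w. (Inl u, w) \<in> parcs (graph_join G H)} = {w. (u, w) \<in> parcs G} <+> pverts H"
      using that by (auto simp: graph_join_def)
    then show ?thesis
      using fin H.pair_finite_verts by (simp add: out_degree_eq_card card_Plus)
  qed
  show "out_degree (with_proj (graph_join G H)) (Inr v)
           = out_degree (with_proj H) v + card (pverts G)" if "v \<in> pverts H"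
  proof -
    have "{w. (Inr v, w) \<in> parcs (graph_join G H)} = pverts G <+> {w. (v, w) \<in> parcs H}"
      using that by (auto simp: graph_join_def)
    then show ?thesis
      using fin G.pair_finite_verts by (simp add: out_degree_eq_card card_Plus)
  qed
qed

lemma pverts_graph_join [simp]: "pverts (graph_join G H) = pverts G <+> pverts H"
  by (simp add: graph_join_def)

lemma edge_count_graph_join:
  assumes "pair_graph G" and "pair_graph H"
  shows "edge_count (graph_join G H)
       = edge_count G + edge_count H + card (pverts G) * card (pverts H)"
proof -
  interpret G: pair_graph G by fact
  interpret H: pair_graph H by fact
  have "2 * edge_count (graph_join G H)
      = (\<Sum>v\<in>pverts G <+> pverts H. out_degree (with_proj (graph_join G H)) v)"
    using sum_out_degree[OF pair_graph_join[OF assms]] by simp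
  also have "\<dots> = (\<Sum>u\<in>pverts G. out_degree (with_proj G) u + card (pverts H))
      + (\<Sum>v\<in>pverts H. out_degree (with_proj H) v + card (pverts G))"
    using G.pair_finite_verts H.pair_finite_verts
    by (simp add: sum.Plus out_degree_graph_join[OF assms])
  also have "\<dots> = 2 * (edge_count G + edge_count H + card (pverts G) * card (pverts H))"
    using sum_out_degree[OF assms(1)] sum_out_degree[OF assms(2)] by (simp add: sum.distrib)
  finally show ?thesis by simp
qed

text \<open>
  Both copies of a vertex \<open>u\<close> are adjacent to the opposite copies of \<open>u\<close> and of its neighbours, so their
  degree exceeds that of \<open>u\<close> by one.
\<close>

lemma edge_count_extended_double_cover:
  assumes "pair_graph G"
  shows "edge_count (extended_double_cover G) = card (pverts G) + 2 * edge_count G"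
proof -
  interpret pair_graph G by fact
  let ?C = "extended_double_cover G"
  have sym: "(u, v) \<in> parcs G \<longleftrightarrow> (v, u) \<in> parcs G" for u v
    using pair_sym_arcs by (auto simp: symmetric_def dest: symD)
  have deg: "out_degree (with_proj ?C) (Inl u) = Suc (out_degree (with_proj G) u)"
    "out_degree (with_proj ?C) (Inr u) = Suc (out_degree (with_proj G) u)"
    if "u \<in> pverts G" for u
  proof -
    let ?N = "insert u {w. (u, w) \<in> parcs G}"
    have "{w. (Inl u, w) \<in> parcs ?C} = Inr ` ?N" "{w. (Inr u, w) \<in> parcs ?C} = Inl ` ?N"
      using that sym by (auto simp: extended_double_cover_def wellformed')
    moreover have "finite {w. (u, w) \<in> parcs G}"
      by (rule finite_subset[OF _ pair_finite_verts]) (auto simp: wellformed')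
    moreover have "(u, u) \<notin> parcs G" using pair_no_loops by fastforce
    ultimately show "out_degree (with_proj ?C) (Inl u) = Suc (out_degree (with_proj G) u)"
      "out_degree (with_proj ?C) (Inr u) = Suc (out_degree (with_proj G) u)"
      by (simp_all only: out_degree_eq_card card_image inj_Inl inj_Inr) simp_all
  qed
  have "2 * edge_count ?C = (\<Sum>v\<in>pverts G <+> pverts G. out_degree (with_proj ?C) v)"
    using sum_out_degree[OF pair_graph_extended_double_cover[OF assms]]
    by (simp add: extended_double_cover_def)
  also have "\<dots> = 2 * (\<Sum>u\<in>pverts G. Suc (out_degree (with_proj G) u))"
    using pair_finite_verts by (simp add: sum.Plus deg)
  also have "\<dots> = 2 * (card (pverts G) + 2 * edge_count G)"
    using sum_out_degree[OF assms] by (simp add: sum_Suc)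
  finally show ?thesis by simp
qed

lemma laplacian_matrix_graph_join:
  assumes "pair_graph G" and "distinct us" and "set us = pverts G"
    and "pair_graph H" and "distinct vs" and "set vs = pverts H"
  shows "laplacian_matrix (map Inl us @ map Inr vs) (graph_join G H)
       = four_block_mat
           (shifted_laplacian (real (length vs)) us G) (const_mat (length us) (length vs) (- 1))
           (const_mat (length vs) (length us) (- 1)) (shifted_laplacian (real (length us)) vs H)"
    (is "?L = ?R")
proof (rule eq_matI)
  have card: "card (pverts G) = length us" "card (pverts H) = length vs"
    using assms by (metis distinct_card)+
  have mem: "i < length us \<Longrightarrow> us ! i \<in> pverts G" "j < length vs \<Longrightarrow> vs ! j \<in> pverts H" for i j
    using assms by auto
  fix i j assume "i < dim_row ?R" "j < dim_col ?R"
  then have ij: "i < length us + length vs" "j < length us + length vs" by simp_all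
  note deg = out_degree_graph_join[OF assms(1,4)]
  have arcs: "(Inl u, Inl v) \<in> parcs (graph_join G H) \<longleftrightarrow> (u, v) \<in> parcs G"
    "(Inr x, Inr y) \<in> parcs (graph_join G H) \<longleftrightarrow> (x, y) \<in> parcs H"
    "(Inl u, Inr y) \<in> parcs (graph_join G H) \<longleftrightarrow> u \<in> pverts G \<and> y \<in> pverts H"
    "(Inr y, Inl u) \<in> parcs (graph_join G H) \<longleftrightarrow> u \<in> pverts G \<and> y \<in> pverts H" for u v x y
    by (auto simp: graph_join_def)
  show "?L $$ (i, j) = ?R $$ (i, j)"
    using ij
    by (auto simp: laplacian_matrix_index shifted_laplacian_index nth_append arcs mem deg card)
qed (use laplacian_matrix_carrier[of "map Inl us @ map Inr vs" "graph_join G H"] in auto)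

section \<open>Joins of equal Laplacian energy\<close>

text \<open>
  The hypothesis \<open>avg\<close> says, without division, that the average degree \<open>a\<close> of the join is at most the
  order of \<open>K\<close>, which is a lower bound for the eigenvalues of the blocks \<open>A\<close> and \<open>B\<close> that come from \<open>H\<^sub>1\<close>
  and \<open>H\<^sub>2\<close>. These are the only eigenvalues in which the two joins can differ, and on them \<open>\<bar>\<nu> - a\<bar>\<close> has
  the same sum for both graphs.
\<close>

lemma laplacian_energy_join_eq:
  fixes H\<^sub>1 :: "'a pair_pre_digraph" and H\<^sub>2 :: "'b pair_pre_digraph" and K :: "'c pair_pre_digraph"
  assumes H\<^sub>1: "pair_graph H\<^sub>1" and H\<^sub>2: "pair_graph H\<^sub>2" and K: "pair_graph K"
    and card_eq: "card (pverts H\<^sub>1) = card (pverts H\<^sub>2)" and edges_eq: "edge_count H\<^sub>1 = edge_count H\<^sub>2"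
    and avg: "2 * edge_count (graph_join H\<^sub>1 K) \<le> card (pverts K) * card (pverts (graph_join H\<^sub>1 K))"
  shows "laplacian_energy (graph_join H\<^sub>1 K) = laplacian_energy (graph_join H\<^sub>2 K)"
proof -
  interpret H\<^sub>1: pair_graph H\<^sub>1 by fact
  interpret H\<^sub>2: pair_graph H\<^sub>2 by fact
  interpret K: pair_graph K by fact
  note fin = H\<^sub>1.pair_finite_verts H\<^sub>2.pair_finite_verts K.pair_finite_verts
  obtain us where us: "distinct us" "set us = pverts H\<^sub>1" using vertex_list fin(1) by blast
  obtain vs where vs: "distinct vs" "set vs = pverts H\<^sub>2" using vertex_list fin(2) by blast
  obtain ws where ws: "distinct ws" "set ws = pverts K" using vertex_list fin(3) by blast
  define n p where "n = length us" and "p = length ws"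
  have len: "length us = n" "length vs = n" "length ws = p"
    using us vs card_eq unfolding n_def p_def by (metis distinct_card)+
  have p: "card (pverts K) = p" using ws len by (metis distinct_card)
  define A B D where "A = shifted_laplacian (real p) us H\<^sub>1" and "B = shifted_laplacian (real p) vs H\<^sub>2"
    and "D = shifted_laplacian (real n) ws K"
  have carr: "A \<in> carrier_mat n n" "B \<in> carrier_mat n n" "D \<in> carrier_mat p p"
    using shifted_laplacian_carrier len by (metis A_def B_def D_def)+
  let ?S = "\<lambda>X. four_block_mat X (const_mat n p (- 1)) (const_mat p n (- 1)) D"
  have spec: "laplacian_spectrum (graph_join H\<^sub>1 K) = proots (char_poly (?S A))"
    "laplacian_spectrum (graph_join H\<^sub>2 K) = proots (char_poly (?S B))"
    using laplacian_spectrum_enum[of "graph_join H\<^sub>1 K" "map Inl us @ map Inr ws"]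
      laplacian_spectrum_enum[of "graph_join H\<^sub>2 K" "map Inl vs @ map Inr ws"]
      laplacian_matrix_graph_join[OF H\<^sub>1 us K ws] laplacian_matrix_graph_join[OF H\<^sub>2 vs K ws]
      us vs ws fin len
    by (auto simp: A_def B_def D_def distinct_map Plus_def)
  have "char_poly (?S A) * char_poly B = char_poly (?S B) * char_poly A"
    using shifted_laplacian_row_sum[OF H\<^sub>1 us] shifted_laplacian_row_sum[OF H\<^sub>2 vs] carr len
    by (intro char_poly_four_block_exchange[where c = "real p"]) (auto simp: A_def B_def)
  moreover have nonzero: "char_poly X \<noteq> 0" if "X \<in> carrier_mat m m" for X :: "real mat" and m
    using degree_monic_char_poly[OF that] by auto
  then have "char_poly (?S A) \<noteq> 0" "char_poly (?S B) \<noteq> 0" "char_poly A \<noteq> 0" "char_poly B \<noteq> 0"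
    using nonzero[OF carr(1)] nonzero[OF carr(2)] nonzero[OF four_block_carrier_mat[OF carr(1,3)]]
      nonzero[OF four_block_carrier_mat[OF carr(2,3)]] by simp_all
  ultimately have exchange: "proots (char_poly (?S A)) + proots (char_poly B)
      = proots (char_poly (?S B)) + proots (char_poly A)"
    by (metis proots_mult)
  define a where "a = 2 * real (edge_count (graph_join H\<^sub>1 K)) / real (card (pverts (graph_join H\<^sub>1 K)))"
  have a: "a = 2 * real (edge_count (graph_join H\<^sub>2 K)) / real (card (pverts (graph_join H\<^sub>2 K)))"
    unfolding a_def using fin card_eq edges_eq H\<^sub>1 H\<^sub>2 K
    by (simp add: edge_count_graph_join card_Plus)
  have "real (2 * edge_count (graph_join H\<^sub>1 K)) \<le> real (p * card (pverts (graph_join H\<^sub>1 K)))"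
    using avg p by (simp only: of_nat_le_iff)
  then have "a \<le> real p"
    unfolding a_def by (cases "card (pverts (graph_join H\<^sub>1 K)) = 0") (simp_all add: divide_le_eq)
  then have rest: "(\<Sum>\<nu>\<in>#proots (char_poly A). \<bar>\<nu> - a\<bar>) = (\<Sum>\<nu>\<in>#proots (char_poly B). \<bar>\<nu> - a\<bar>)"
    unfolding A_def B_def
    using sum_abs_shifted_laplacian_proots[OF H\<^sub>1 us] sum_abs_shifted_laplacian_proots[OF H\<^sub>2 vs]
      card_eq edges_eq by simp
  have "laplacian_energy (graph_join H\<^sub>1 K) + (\<Sum>\<nu>\<in>#proots (char_poly B). \<bar>\<nu> - a\<bar>)
      = (\<Sum>\<nu>\<in>#proots (char_poly (?S A)) + proots (char_poly B). \<bar>\<nu> - a\<bar>)"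
    by (simp only: laplacian_energy_def spec a_def image_mset_union sum_mset.union)
  also have "\<dots> = laplacian_energy (graph_join H\<^sub>2 K) + (\<Sum>\<nu>\<in>#proots (char_poly A). \<bar>\<nu> - a\<bar>)"
    by (simp only: exchange laplacian_energy_def spec a image_mset_union sum_mset.union)
  finally show ?thesis using rest by simp
qed

theorem theorem4p3:
  fixes G\<^sub>1 :: "'a pair_pre_digraph" and G\<^sub>2 :: "'b pair_pre_digraph"
    and n m p k :: nat
  assumes "pair_graph G\<^sub>1" and "card (pverts G\<^sub>1) = n" and "edge_count G\<^sub>1 = m"
    and "pair_graph G\<^sub>2" and "card (pverts G\<^sub>2) = n" and "edge_count G\<^sub>2 = m"
    and "k \<ge> 3" and "p \<ge> 2 * n + k"
    and "real m \<le> (real k - 1) * real n / 2 + (real k)\<^sup>2 / 4"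
  shows "laplacian_energy (graph_join (extended_double_cover G\<^sub>1) (empty_graph p))
       = laplacian_energy (graph_join (extended_double_cover G\<^sub>2) (empty_graph p))"
proof (rule laplacian_energy_join_eq)
  let ?C = "extended_double_cover G\<^sub>1"
  have card: "card (pverts (extended_double_cover G\<^sub>1)) = 2 * n"
    "card (pverts (extended_double_cover G\<^sub>2)) = 2 * n"
    using pair_fin_digraph.pair_finite_verts[of G\<^sub>1] pair_fin_digraph.pair_finite_verts[of G\<^sub>2] assms
    by (auto simp: extended_double_cover_def card_Plus pair_graph_def pair_digraph_def)
  then show "card (pverts (extended_double_cover G\<^sub>1)) = card (pverts (extended_double_cover G\<^sub>2))"
    by simp
  show "edge_count (extended_double_cover G\<^sub>1) = edge_count (extended_double_cover G\<^sub>2)"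
    using assms by (simp add: edge_count_extended_double_cover)
  have empty: "card (pverts (empty_graph p)) = p" "edge_count (empty_graph p) = 0"
    by (simp_all add: empty_graph_def edge_count_def)
  have C: "pair_graph ?C" using assms(1) by (rule pair_graph_extended_double_cover)
  have edges: "edge_count (graph_join ?C (empty_graph p)) = n + 2 * m + 2 * n * p"
    using edge_count_graph_join[OF C pair_graph_empty_graph[of p]] card(1) empty
      edge_count_extended_double_cover[OF assms(1)] assms(2,3) by simp
  have verts: "card (pverts (graph_join ?C (empty_graph p))) = 2 * n + p"
    using pair_fin_digraph.pair_finite_verts[of ?C] C card(1)
    by (auto simp: card_Plus empty_graph_def pair_graph_def pair_digraph_def)
  obtain q where q: "p = 2 * n + k + q" using assms(8) by (metis le_iff_add)
  \<comment> \<open>the bound on \<open>m\<close> in integers, equivalent to \<open>4 m + 2 n \<le> (2 n + k) k\<close>\<close>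
  have "real (4 * m + 2 * n) \<le> real (2 * n * k + k * k)"
    using assms(9) by (simp add: field_simps power2_eq_square)
  then have "4 * m + 2 * n \<le> 2 * n * k + k * k" by (simp only: of_nat_le_iff)
  also have "\<dots> \<le> p * (k + q)" unfolding q by (simp add: algebra_simps)
  finally have "2 * (n + 2 * m + 2 * n * p) \<le> p * (2 * n + p)"
    unfolding q by (simp add: algebra_simps)
  then show "2 * edge_count (graph_join ?C (empty_graph p))
      \<le> card (pverts (empty_graph p)) * card (pverts (graph_join ?C (empty_graph p)))"
    unfolding edges verts empty .
qed (use assms in \<open>simp_all add: pair_graph_extended_double_cover pair_graph_empty_graph\<close>)

end
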